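(* Let $A,N,K\in\mathbb{R}^{n\times n}$ with $N,K$ symmetric positive semi-definite, let $\alpha,\beta,\gamma>0$, and let $(X_k,Y_k,Z_k,W_k,\Lambda_k,\Pi_k,\Gamma_k)_{k\ge0}$ be a sequence in $(\mathbb{R}^{n\times n})^7$ generated, from an arbitrary starting point, by the ADMM iteration $$\begin{cases} X_{k+1}=[W_k^TW_k+\alpha AA^T+\beta I_n]^{-1}[W_k^T(Y_k+Z_kA+K)+A\Lambda_k+\Pi_k+\alpha AY_k+\beta Z_k],\\ Y_{k+1}=(1+\alpha)^{-1}[W_kX_{k+1}+\alpha A^TX_{k+1}-Z_kA-K-\Lambda_k],\\ Z_{k+1}=[(W_kX_{k+1}-Y_{k+1}-K)A^T-\Pi_k+\Gamma_kN^T+\beta X_{k+1}+\gamma W_kN^T][AA^T+\beta I_n+\gamma NN^T]^{-1},\\ W_{k+1}=[(Y_{k+1}+Z_{k+1}A+K)X_{k+1}^T-\Gamma_k+\gamma Z_{k+1}N][X_{k+1}X_{k+1}^T+\gamma I_n]^{-1},\\ \Lambda_{k+1}=\Lambda_k-\alpha(A^TX_{k+1}-Y_{k+1}),\\ \Pi_{k+1}=\Pi_k-\beta(X_{k+1}-Z_{k+1}),\\ \Gamma_{k+1}=\Gamma_k-\gamma(Z_{k+1}N-W_{k+1}). \end{cases}$$ Suppose that the multiplier sequence $(\Lambda_k,\Pi_k,\Gamma_k)$ is bounded and satisfies $$\sum_{k=0}^\infty\left(\|\Lambda_{k+1}-\Lambda_k\|_F^2+\|\Pi_{k+1}-\Pi_k\|_F^2+\|\Gamma_{k+1}-\Gamma_k\|_F^2\right)<\infty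 .$$ Then any accumulation point $(X^*,Y^*,Z^*,W^*,\Lambda^*,\Pi^*,\Gamma^* )$ of $(X_k,Y_k,Z_k,W_k,\Lambda_k,\Pi_k,\Gamma_k)$ satisfies the KKT optimality conditions $$\begin{cases} W^{*T}W^*X^*-W^{*T}(Y^*+Z^*A+K)-A\Lambda^*-\Pi^*=0,\\ Y^*+Z^*A-W^*X^*+K+\Lambda^*=0,\\ Z^*AA^T+(Y^*-W^*X^*+K)A^T+\Pi^*-\Gamma^*N^T=0,\\ W^*X^*X^{*T}-(Y^*+Z^*A+K)X^{*T}+\Gamma^*=0,\\ A^TX^*-Y^*=0,\\ X^*-Z^*=0,\\ Z^*N-W^*=0 \end{cases}$$ of the problem $\min_{(X,Y,Z,W)}\frac12\|Y+ZA-WX+K\|_F^2$ subject to $A^TX=Y$, $X=Z$, $ZN=W$.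
   Context: $\|\cdot\|_F$ is the Frobenius norm and $\langle P,Q\rangle=\mathrm{tr}(P^TQ)$. The problem is a reformulation of the continuous algebraic Riccati equation $A^TX+XA-XNX+K=0$. Its augmented Lagrangian is $$\mathcal{L}_{\mathcal A}(X,Y,Z,W,\Lambda,\Pi,\Gamma)=\tfrac12\|Y+ZA-WX+K\|_F^2-\langle\Lambda,A^TX-Y\rangle-\langle\Pi,X-Z\rangle-\langle\Gamma,ZN-W\rangle+\tfrac{\alpha}{2}\|A^TX-Y\|_F^2+\tfrac{\beta}{2}\|X-Z\|_F^2+\tfrac{\gamma}{2}\|ZN-W\|_F^2,$$ and the first four updates in the ADMM iteration are the successive exact minimizations of $\mathcal{L}_{\mathcal A}$ over $X$, then $Y$, then $Z$, then $W$, the other variables being held at their most recent values. *)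

theory Defs
  imports "HOL-Analysis.Analysis"
begin

text \<open>The inner product and norm that the library puts on square matrices are the trace
  inner product and the Frobenius norm.\<close>

lemma inner_matrix_eq_trace:
  fixes P Q :: "real^'n^'n"
  shows "P \<bullet> Q = trace (transpose P ** Q)"
proof -
  have "P \<bullet> Q = (\<Sum>i\<in>UNIV. \<Sum>j\<in>UNIV. P $ i $ j * Q $ i $ j)"
    by (simp add: inner_vec_def)
  also have "\<dots> = (\<Sum>j\<in>UNIV. \<Sum>i\<in>UNIV. P $ i $ j * Q $ i $ j)"
    by (rule sum.swap)
  finally show ?thesis
    by (simp add: trace_def matrix_matrix_mult_def transpose_def)
qed

lemma norm_matrix_eq_frobenius:
  fixes P :: "real^'n^'n"
  shows "norm P = sqrt (trace (transpose P ** P))"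
  by (simp add: norm_eq_sqrt_inner inner_matrix_eq_trace)

definition sym_psd :: "real^'n^'n \<Rightarrow> bool" where
  "sym_psd M \<longleftrightarrow> transpose M = M \<and> (\<forall>v. 0 \<le> v \<bullet> (M *v v))"

text \<open>In every update the matrix under \<open>matrix_inv\<close> is positive definite when
  \<open>\<alpha>, \<beta>, \<gamma> > 0\<close>, so \<open>matrix_inv\<close> is the genuine inverse there.\<close>

definition admm_iteration ::
  "real^'n^'n \<Rightarrow> real^'n^'n \<Rightarrow> real^'n^'n \<Rightarrow> real \<Rightarrow> real \<Rightarrow> real \<Rightarrow>
   (nat \<Rightarrow> real^'n^'n) \<Rightarrow> (nat \<Rightarrow> real^'n^'n) \<Rightarrow> (nat \<Rightarrow> real^'n^'n) \<Rightarrow> (nat \<Rightarrow> real^'n^'n) \<Rightarrow>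
   (nat \<Rightarrow> real^'n^'n) \<Rightarrow> (nat \<Rightarrow> real^'n^'n) \<Rightarrow> (nat \<Rightarrow> real^'n^'n) \<Rightarrow> bool" where
  "admm_iteration A N K \<alpha> \<beta> \<gamma> X Y Z W Lam Pim Gam \<longleftrightarrow> (\<forall>k.
     X (Suc k) =
       matrix_inv (transpose (W k) ** W k + \<alpha> *\<^sub>R (A ** transpose A) + \<beta> *\<^sub>R mat 1) **
       (transpose (W k) ** (Y k + Z k ** A + K) + A ** Lam k + Pim k
        + \<alpha> *\<^sub>R (A ** Y k) + \<beta> *\<^sub>R Z k) \<and>
     Y (Suc k) =
       inverse (1 + \<alpha>) *\<^sub>R
       (W k ** X (Suc k) + \<alpha> *\<^sub>R (transpose A ** X (Suc k)) - Z k ** A - K - Lam k) \<and>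
     Z (Suc k) =
       ((W k ** X (Suc k) - Y (Suc k) - K) ** transpose A - Pim k + Gam k ** transpose N
        + \<beta> *\<^sub>R X (Suc k) + \<gamma> *\<^sub>R (W k ** transpose N)) **
       matrix_inv (A ** transpose A + \<beta> *\<^sub>R mat 1 + \<gamma> *\<^sub>R (N ** transpose N)) \<and>
     W (Suc k) =
       ((Y (Suc k) + Z (Suc k) ** A + K) ** transpose (X (Suc k)) - Gam k
        + \<gamma> *\<^sub>R (Z (Suc k) ** N)) **
       matrix_inv (X (Suc k) ** transpose (X (Suc k)) + \<gamma> *\<^sub>R mat 1) \<and>
     Lam (Suc k) = Lam k - \<alpha> *\<^sub>R (transpose A ** X (Suc k) - Y (Suc k)) \<and>
     Pim (Suc k) = Pim k - \<beta> *\<^sub>R (X (Suc k) - Z (Suc k)) \<and>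
     Gam (Suc k) = Gam k - \<gamma> *\<^sub>R (Z (Suc k) ** N - W (Suc k)))"

definition kkt_point ::
  "real^'n^'n \<Rightarrow> real^'n^'n \<Rightarrow> real^'n^'n \<Rightarrow>
   real^'n^'n \<Rightarrow> real^'n^'n \<Rightarrow> real^'n^'n \<Rightarrow> real^'n^'n \<Rightarrow>
   real^'n^'n \<Rightarrow> real^'n^'n \<Rightarrow> real^'n^'n \<Rightarrow> bool" where
  "kkt_point A N K X Y Z W Lam Pim Gam \<longleftrightarrow>
     transpose W ** W ** X - transpose W ** (Y + Z ** A + K) - A ** Lam - Pim = 0 \<and>
     Y + Z ** A - W ** X + K + Lam = 0 \<and>
     Z ** A ** transpose A + (Y - W ** X + K) ** transpose A + Pim - Gam ** transpose N = 0 \<and>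
     W ** X ** transpose X - (Y + Z ** A + K) ** transpose X + Gam = 0 \<and>
     transpose A ** X - Y = 0 \<and>
     X - Z = 0 \<and>
     Z ** N - W = 0"

text \<open>The equations of \<open>kkt_point\<close> say that the point is feasible and that the Lagrangian of
  the problem is stationary in the four primal variables.\<close>

definition lagrangian ::
  "real^'n^'n \<Rightarrow> real^'n^'n \<Rightarrow> real^'n^'n \<Rightarrow>
   real^'n^'n \<Rightarrow> real^'n^'n \<Rightarrow> real^'n^'n \<Rightarrow> real^'n^'n \<Rightarrow>
   real^'n^'n \<Rightarrow> real^'n^'n \<Rightarrow> real^'n^'n \<Rightarrow> real" where
  "lagrangian A N K X Y Z W Lam Pim Gam =
     1/2 * (norm (Y + Z ** A - W ** X + K))\<^sup>2
     - Lam \<bullet> (transpose A ** X - Y) - Pim \<bullet> (X - Z) - Gam \<bullet> (Z ** N - W)"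

lemma inner_matrix_mult_left:
  fixes P Q R :: "real^'n^'n"
  shows "R \<bullet> (P ** Q) = (transpose P ** R) \<bullet> Q"
  by (simp add: inner_matrix_eq_trace matrix_transpose_mul matrix_mul_assoc)

lemma inner_matrix_mult_right:
  fixes P Q R :: "real^'n^'n"
  shows "R \<bullet> (P ** Q) = (R ** transpose Q) \<bullet> P"
  by (metis inner_matrix_eq_trace matrix_transpose_mul matrix_mul_assoc trace_mul_sym
      transpose_transpose)

lemma bounded_bilinear_matrix_mult:
  "bounded_bilinear ((**) :: real^'n^'n \<Rightarrow> real^'n^'n \<Rightarrow> real^'n^'n)"
  unfolding bilinear_conv_bounded_bilinear[symmetric]
  by (auto simp: bilinear_def matrix_matrix_mult_def vec_eq_iff sum.distrib sum_distrib_left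
      algebra_simps intro!: linearI)

lemmas matrix_ring_simps =
  bounded_bilinear.add_left[OF bounded_bilinear_matrix_mult]
  bounded_bilinear.add_right[OF bounded_bilinear_matrix_mult]
  bounded_bilinear.diff_left[OF bounded_bilinear_matrix_mult]
  bounded_bilinear.diff_right[OF bounded_bilinear_matrix_mult]
  bounded_bilinear.minus_left[OF bounded_bilinear_matrix_mult]
  bounded_bilinear.minus_right[OF bounded_bilinear_matrix_mult]

lemma kkt_point_iff_stationary:
  fixes A N K :: "real^'n^'n"
  shows "kkt_point A N K X Y Z W Lam Pim Gam \<longleftrightarrow>
    ((\<lambda>(X, Y, Z, W). lagrangian A N K X Y Z W Lam Pim Gam) has_derivative (\<lambda>_. 0)) (at (X, Y, Z, W)) \<and>
    transpose A ** X = Y \<and> X = Z \<and> Z ** N = W"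
proof -
  define R where "R = Y + Z ** A - W ** X + K"
  define gX where "gX = - (transpose W ** R) - A ** Lam - Pim"
  define gY where "gY = R + Lam"
  define gZ where "gZ = R ** transpose A + Pim - Gam ** transpose N"
  define gW where "gW = - (R ** transpose X) + Gam"
  let ?f = "\<lambda>(X, Y, Z, W). lagrangian A N K X Y Z W Lam Pim Gam"
  note [derivative_intros] = bounded_bilinear.FDERIV[OF bounded_bilinear_matrix_mult]
  have g: "R \<bullet> (dY + dZ ** A - (W ** dX + dW ** X))
      - Lam \<bullet> (transpose A ** dX - dY) - Pim \<bullet> (dX - dZ) - Gam \<bullet> (dZ ** N - dW)
      = gX \<bullet> dX + gY \<bullet> dY + gZ \<bullet> dZ + gW \<bullet> dW" for dX dY dZ dW
    unfolding gX_def gY_def gZ_def gW_def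
    by (simp add: inner_simps inner_matrix_mult_left[of _ W] inner_matrix_mult_left[of _ "transpose A"]
        inner_matrix_mult_right[of _ _ A] inner_matrix_mult_right[of _ _ X]
        inner_matrix_mult_right[of _ _ N])
  have D: "(?f has_derivative (\<lambda>h. (gX, gY, gZ, gW) \<bullet> h)) (at (X, Y, Z, W))"
    unfolding lagrangian_def case_prod_unfold power2_norm_eq_inner
    apply (rule has_derivative_eq_rhs)
     apply (rule derivative_intros)+
    apply (clarsimp simp: fun_eq_iff R_def[symmetric] inner_commute)
    apply (simp only: g)
    apply (simp add: inner_commute)
    done
  have "(?f has_derivative (\<lambda>_. 0)) (at (X, Y, Z, W)) \<longleftrightarrow> (gX, gY, gZ, gW) = 0"
  proof
    assume "(?f has_derivative (\<lambda>_. 0)) (at (X, Y, Z, W))"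
    then have "(\<lambda>h. (gX, gY, gZ, gW) \<bullet> h) = (\<lambda>_. 0)"
      by (rule has_derivative_unique[OF D])
    then have "(gX, gY, gZ, gW) \<bullet> (gX, gY, gZ, gW) = 0" by meson
    then show "(gX, gY, gZ, gW) = 0" by (simp only: inner_eq_zero_iff)
  next
    assume "(gX, gY, gZ, gW) = 0"
    with D show "(?f has_derivative (\<lambda>_. 0)) (at (X, Y, Z, W))" by (simp only: inner_zero_left)
  qed
  moreover have "gX = transpose W ** W ** X - transpose W ** (Y + Z ** A + K) - A ** Lam - Pim"
    and "gY = Y + Z ** A - W ** X + K + Lam"
    and "gZ = Z ** A ** transpose A + (Y - W ** X + K) ** transpose A + Pim - Gam ** transpose N"
    and "gW = W ** X ** transpose X - (Y + Z ** A + K) ** transpose X + Gam"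
    by (simp_all add: gX_def gY_def gZ_def gW_def R_def matrix_ring_simps matrix_mul_assoc)
  ultimately show ?thesis
    by (auto simp: kkt_point_def zero_prod_def)
qed

end

theory Submission
  imports Defs
begin

text \<open>The augmented Lagrangian is strongly convex in each primal block, so each exact
  minimization lowers it by a multiple of the squared step, while the multiplier updates raise
  it by \<open>\<parallel>\<Delta>\<Lambda>\<parallel>\<^sup>2/\<alpha> + \<parallel>\<Delta>\<Pi>\<parallel>\<^sup>2/\<beta> + \<parallel>\<Delta>\<Gamma>\<parallel>\<^sup>2/\<gamma>\<close>, which is summable. Completing the square, it is
  bounded below because the multipliers are bounded. Hence the squared primal steps are summable
  as well, consecutive iterates share their accumulation points, and the KKT equations are the
  limits of the update equations.\<close>

section \<open>Matrix identities and invertibility of the update matrices\<close>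

lemmas matrix_scaleR_simps =
  bounded_bilinear.scaleR_left[OF bounded_bilinear_matrix_mult]
  bounded_bilinear.scaleR_right[OF bounded_bilinear_matrix_mult]

lemma inner_matrix_mult_transpose_self:
  fixes P :: "real^'n^'m"
  shows "v \<bullet> ((P ** transpose P) *v v) = (transpose P *v v) \<bullet> (transpose P *v v)"
  by (simp add: dot_lmul_matrix flip: matrix_vector_mul_assoc)

text \<open>A vector in the kernel makes the quadratic form vanish, so the kernel is trivial; for a
  square matrix this already gives a two-sided inverse.\<close>

lemma invertible_if_positive_definite:
  fixes M :: "real^'n^'n"
  assumes "\<And>v. v \<noteq> 0 \<Longrightarrow> 0 < v \<bullet> (M *v v)"
  shows "invertible M"
  unfolding invertible_left_inverse matrix_left_invertible_ker
proof (intro allI impI)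
  fix v assume "M *v v = 0"
  then show "v = 0" using assms[of v] by fastforce
qed

text \<open>\<open>matrix_inv\<close> is a choice operator, and invertibility makes the chosen
  matrix a genuine two-sided inverse. This trades the inverses in the updates for linear
  equations.\<close>

lemma matrix_inv_mult_eq:
  fixes M :: "real^'n^'n"
  assumes "invertible M"
  shows "U = matrix_inv M ** V \<Longrightarrow> M ** U = V"
    and "U = V ** matrix_inv M \<Longrightarrow> U ** M = V"
proof -
  have "M ** matrix_inv M = mat 1 \<and> matrix_inv M ** M = mat 1"
    using assms unfolding invertible_def matrix_inv_def by (rule someI_ex)
  then show "U = matrix_inv M ** V \<Longrightarrow> M ** U = V" "U = V ** matrix_inv M \<Longrightarrow> U ** M = V"
    by (auto simp: matrix_mul_assoc) (simp flip: matrix_mul_assoc)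
qed

text \<open>The two Gram terms contribute nonnegative squares to the quadratic form and
  \<open>b *\<^sub>R mat 1\<close> makes it strictly positive. This one shape covers the matrices
  inverted in the X, Z and W updates.\<close>

lemma invertible_normal_matrix:
  fixes P Q :: "real^'n^'n"
  assumes "0 < b" "0 \<le> a" "0 \<le> c"
  shows "invertible (c *\<^sub>R (P ** transpose P) + a *\<^sub>R (Q ** transpose Q) + b *\<^sub>R mat 1)"
proof (rule invertible_if_positive_definite)
  fix v :: "real^'n" assume "v \<noteq> 0"
  have "v \<bullet> ((c *\<^sub>R (P ** transpose P) + a *\<^sub>R (Q ** transpose Q) + b *\<^sub>R mat 1) *v v) =
     c * ((transpose P *v v) \<bullet> (transpose P *v v)) + a * ((transpose Q *v v) \<bullet> (transpose Q *v v))
     + b * (v \<bullet> v)"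
    by (simp add: matrix_vector_mult_add_rdistrib inner_add_right inner_matrix_mult_transpose_self
        flip: scaleR_matrix_vector_assoc)
  also have "\<dots> > 0"
    using assms \<open>v \<noteq> 0\<close> by (simp add: add_nonneg_pos)
  finally show "0 < v \<bullet> ((c *\<^sub>R (P ** transpose P) + a *\<^sub>R (Q ** transpose Q) + b *\<^sub>R mat 1) *v v)" .
qed

section \<open>The augmented Lagrangian: lower bound and change in each block\<close>

definition aug_lagrangian ::
  "real^'n^'n \<Rightarrow> real^'n^'n \<Rightarrow> real^'n^'n \<Rightarrow> real \<Rightarrow> real \<Rightarrow> real \<Rightarrow>
   real^'n^'n \<Rightarrow> real^'n^'n \<Rightarrow> real^'n^'n \<Rightarrow> real^'n^'n \<Rightarrow>
   real^'n^'n \<Rightarrow> real^'n^'n \<Rightarrow> real^'n^'n \<Rightarrow> real" where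
  "aug_lagrangian A N K \<alpha> \<beta> \<gamma> X Y Z W Lam Pim Gam =
     lagrangian A N K X Y Z W Lam Pim Gam + \<alpha>/2 * (norm (transpose A ** X - Y))\<^sup>2
     + \<beta>/2 * (norm (X - Z))\<^sup>2 + \<gamma>/2 * (norm (Z ** N - W))\<^sup>2"

text \<open>This is the exact second-order Taylor expansion at \<open>v\<close>, with the weight
  \<open>c/2\<close> that every quadratic term of \<open>aug_lagrangian\<close> carries.\<close>

lemma half_norm_square_expand:
  fixes u v :: "'a::real_inner"
  shows "c/2 * (norm u)\<^sup>2 = c/2 * (norm v)\<^sup>2 + c * (v \<bullet> (u - v)) + c/2 * (norm (u - v))\<^sup>2"
proof -
  have "(norm u)\<^sup>2 = (norm v)\<^sup>2 + 2 * (v \<bullet> (u - v)) + (norm (u - v))\<^sup>2"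
    by (simp add: power2_norm_eq_inner inner_simps inner_commute)
  then show ?thesis by (simp add: distrib_left)
qed

text \<open>Completing the square in \<open>v\<close>: the penalty absorbs the multiplier term, and
  the bound no longer depends on \<open>v\<close>.\<close>

lemma penalized_inner_ge:
  fixes a v :: "'a::real_inner"
  assumes "0 < c"
  shows "- (norm a)\<^sup>2 / (2 * c) \<le> c/2 * (norm v)\<^sup>2 - a \<bullet> v"
proof -
  have "0 \<le> (norm (c *\<^sub>R v - a))\<^sup>2 / (2 * c)" using assms by simp
  also have "\<dots> = c/2 * (norm v)\<^sup>2 - a \<bullet> v + (norm a)\<^sup>2 / (2 * c)"
    unfolding power2_norm_eq_inner using assms by (simp add: inner_simps inner_commute field_simps)
  finally show ?thesis by simp
qed

text \<open>Each multiplier term is paired with the penalty on the same constraint, and the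
  least-squares term is nonnegative. The bound depends on the multipliers only.\<close>

lemma aug_lagrangian_ge:
  assumes "0 < \<alpha>" "0 < \<beta>" "0 < \<gamma>"
  shows "- ((norm Lam)\<^sup>2 / (2 * \<alpha>) + (norm Pim)\<^sup>2 / (2 * \<beta>) + (norm Gam)\<^sup>2 / (2 * \<gamma>))
    \<le> aug_lagrangian A N K \<alpha> \<beta> \<gamma> X Y Z W Lam Pim Gam"
  using penalized_inner_ge[OF assms(1), of Lam "transpose A ** X - Y"]
    penalized_inner_ge[OF assms(2), of Pim "X - Z"]
    penalized_inner_ge[OF assms(3), of Gam "Z ** N - W"]
    zero_le_power2[of "norm (Y + Z ** A - W ** X + K)"]
  unfolding aug_lagrangian_def lagrangian_def by argo

text \<open>The equation \<open>st\<close> is stationarity in the X block, so the expansion about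
  \<open>X'\<close> has no linear part. Its quadratic part comes from \<open>W ** D\<close>,
  \<open>transpose A ** D\<close> and \<open>D\<close>; only the last, with weight
  \<open>\<beta>/2\<close>, is kept.\<close>

lemma aug_lagrangian_descent_X:
  fixes A N K :: "real^'n^'n"
  assumes "0 < \<alpha>"
    and st: "(transpose W ** W + \<alpha> *\<^sub>R (A ** transpose A) + \<beta> *\<^sub>R mat 1) ** X' =
      transpose W ** (Y + Z ** A + K) + A ** Lam + Pim + \<alpha> *\<^sub>R (A ** Y) + \<beta> *\<^sub>R Z"
  shows "aug_lagrangian A N K \<alpha> \<beta> \<gamma> X' Y Z W Lam Pim Gam + \<beta>/2 * (norm (X' - X))\<^sup>2
    \<le> aug_lagrangian A N K \<alpha> \<beta> \<gamma> X Y Z W Lam Pim Gam"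
proof -
  define D where "D = X - X'"
  define R where "R = Y + Z ** A - W ** X' + K"
  have X: "X = X' + D" by (simp add: D_def)
  \<comment> \<open>The left side is the gradient of \<open>aug_lagrangian\<close> in the X block at
    \<open>X'\<close>. Pairing it with \<open>D\<close> and moving factors across the inner product
    gives the directional derivative \<open>g\<close>.\<close>
  have "- (transpose W ** R) - A ** Lam - Pim + \<alpha> *\<^sub>R (A ** (transpose A ** X' - Y))
      + \<beta> *\<^sub>R (X' - Z) = 0"
    using st unfolding R_def
    by (simp add: matrix_ring_simps matrix_scaleR_simps matrix_mul_assoc algebra_simps)
  then have "(- (transpose W ** R) - A ** Lam - Pim + \<alpha> *\<^sub>R (A ** (transpose A ** X' - Y))
      + \<beta> *\<^sub>R (X' - Z)) \<bullet> D = 0" by simp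
  then have g: "R \<bullet> (- (W ** D)) - Lam \<bullet> (transpose A ** D) - Pim \<bullet> D
      + \<alpha> * ((transpose A ** X' - Y) \<bullet> (transpose A ** D)) + \<beta> * ((X' - Z) \<bullet> D) = 0"
    by (simp add: inner_diff_left inner_add_left inner_matrix_mult_left[of _ W]
        inner_matrix_mult_left[of _ "transpose A"])
  \<comment> \<open>Each residual is affine in X, so its change is linear in \<open>D\<close>.
    Unfolding \<open>d\<close> in the quadratic expansions turns their linear terms into those of
    \<open>g\<close>.\<close>
  have d: "Y + Z ** A - W ** X + K - R = - (W ** D)"
    "transpose A ** X - Y - (transpose A ** X' - Y) = transpose A ** D"
    "X - Z - (X' - Z) = D"
    by (simp_all add: X R_def matrix_ring_simps)
  have i: "Lam \<bullet> (transpose A ** X - Y) = Lam \<bullet> (transpose A ** X' - Y) + Lam \<bullet> (transpose A ** D)"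
    "Pim \<bullet> (X - Z) = Pim \<bullet> (X' - Z) + Pim \<bullet> D"
    by (simp_all add: X matrix_ring_simps inner_simps)
  have "0 \<le> \<alpha>/2 * (norm (transpose A ** D))\<^sup>2" using assms by simp
  moreover have n: "norm (X' - X) = norm D" by (simp add: D_def norm_minus_commute)
  ultimately show ?thesis
    using g zero_le_power2[of "norm (- (W ** D))"]
      half_norm_square_expand[of 1 "Y + Z ** A - W ** X + K" R, unfolded d]
      half_norm_square_expand[of \<alpha> "transpose A ** X - Y" "transpose A ** X' - Y", unfolded d]
      half_norm_square_expand[of \<beta> "X - Z" "X' - Z", unfolded d]
    unfolding aug_lagrangian_def lagrangian_def i n R_def[symmetric] inner_minus_right mult_minus_right norm_minus_cancel
      add_divide_distrib distrib_right
    by linarith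
qed

text \<open>As for X, the linear part vanishes at \<open>Y'\<close>. Both the residual and the first
  constraint change by exactly \<open>D\<close> up to sign, so the weights 1/2 and \<alpha>/2 add up
  and equality in fact holds.\<close>

lemma aug_lagrangian_descent_Y:
  fixes A N K :: "real^'n^'n"
  assumes st: "(1 + \<alpha>) *\<^sub>R Y' = W ** X + \<alpha> *\<^sub>R (transpose A ** X) - Z ** A - K - Lam"
  shows "aug_lagrangian A N K \<alpha> \<beta> \<gamma> X Y' Z W Lam Pim Gam + (1 + \<alpha>)/2 * (norm (Y' - Y))\<^sup>2
    \<le> aug_lagrangian A N K \<alpha> \<beta> \<gamma> X Y Z W Lam Pim Gam"
proof -
  define D where "D = Y - Y'"
  define R where "R = Y' + Z ** A - W ** X + K"
  have Y: "Y = Y' + D" by (simp add: D_def)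
  have "R + Lam - \<alpha> *\<^sub>R (transpose A ** X - Y') = 0"
    using st unfolding R_def by (simp add: algebra_simps)
  then have "(R + Lam - \<alpha> *\<^sub>R (transpose A ** X - Y')) \<bullet> D = 0" by simp
  then have g: "R \<bullet> D + Lam \<bullet> D + \<alpha> * ((transpose A ** X - Y') \<bullet> (- D)) = 0"
    by (simp add: inner_diff_left inner_add_left algebra_simps)
  have d: "Y + Z ** A - W ** X + K - R = D"
    "transpose A ** X - Y - (transpose A ** X - Y') = - D"
    by (simp_all add: Y R_def)
  have i: "Lam \<bullet> (transpose A ** X - Y) = Lam \<bullet> (transpose A ** X - Y') - Lam \<bullet> D"
    by (simp add: Y inner_simps)
  have n: "norm (Y' - Y) = norm D" by (simp add: D_def norm_minus_commute)
  show ?thesis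
    using g half_norm_square_expand[of 1 "Y + Z ** A - W ** X + K" R, unfolded d]
      half_norm_square_expand[of \<alpha> "transpose A ** X - Y" "transpose A ** X - Y'", unfolded d]
    unfolding aug_lagrangian_def lagrangian_def i n R_def[symmetric] inner_minus_right mult_minus_right norm_minus_cancel
      add_divide_distrib distrib_right
    by linarith
qed

text \<open>As for X: the linear part vanishes at \<open>Z'\<close>, the squares of
  \<open>D ** A\<close> and \<open>D ** N\<close> are dropped, and the penalty on
  \<open>X - Z\<close> supplies the decrease.\<close>

lemma aug_lagrangian_descent_Z:
  fixes A N K :: "real^'n^'n"
  assumes "0 < \<gamma>"
    and st: "Z' ** (A ** transpose A + \<beta> *\<^sub>R mat 1 + \<gamma> *\<^sub>R (N ** transpose N)) =
      (W ** X - Y - K) ** transpose A - Pim + Gam ** transpose N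
        + \<beta> *\<^sub>R X + \<gamma> *\<^sub>R (W ** transpose N)"
  shows "aug_lagrangian A N K \<alpha> \<beta> \<gamma> X Y Z' W Lam Pim Gam + \<beta>/2 * (norm (Z' - Z))\<^sup>2
    \<le> aug_lagrangian A N K \<alpha> \<beta> \<gamma> X Y Z W Lam Pim Gam"
proof -
  define D where "D = Z - Z'"
  define R where "R = Y + Z' ** A - W ** X + K"
  have Z: "Z = Z' + D" by (simp add: D_def)
  have "R ** transpose A + Pim - Gam ** transpose N - \<beta> *\<^sub>R (X - Z')
      + \<gamma> *\<^sub>R ((Z' ** N - W) ** transpose N) = 0"
    using st unfolding R_def
    by (simp add: matrix_ring_simps matrix_scaleR_simps matrix_mul_assoc algebra_simps)
  then have "(R ** transpose A + Pim - Gam ** transpose N - \<beta> *\<^sub>R (X - Z')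
      + \<gamma> *\<^sub>R ((Z' ** N - W) ** transpose N)) \<bullet> D = 0" by simp
  then have g: "R \<bullet> (D ** A) + Pim \<bullet> D - Gam \<bullet> (D ** N) + \<beta> * ((X - Z') \<bullet> (- D))
      + \<gamma> * ((Z' ** N - W) \<bullet> (D ** N)) = 0"
    by (simp add: inner_diff_left inner_add_left inner_matrix_mult_right[of _ _ A]
        inner_matrix_mult_right[of _ _ N] algebra_simps)
  have d: "Y + Z ** A - W ** X + K - R = D ** A"
    "Z ** N - W - (Z' ** N - W) = D ** N"
    "X - Z - (X - Z') = - D"
    by (simp_all add: Z R_def matrix_ring_simps)
  have i: "Gam \<bullet> (Z ** N - W) = Gam \<bullet> (Z' ** N - W) + Gam \<bullet> (D ** N)"
    "Pim \<bullet> (X - Z) = Pim \<bullet> (X - Z') - Pim \<bullet> D"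
    by (simp_all add: Z matrix_ring_simps inner_simps)
  have "0 \<le> \<gamma>/2 * (norm (D ** N))\<^sup>2" using assms by simp
  moreover have n: "norm (Z' - Z) = norm D" by (simp add: D_def norm_minus_commute)
  ultimately show ?thesis
    using g zero_le_power2[of "norm (D ** A)"]
      half_norm_square_expand[of 1 "Y + Z ** A - W ** X + K" R, unfolded d]
      half_norm_square_expand[of \<gamma> "Z ** N - W" "Z' ** N - W", unfolded d]
      half_norm_square_expand[of \<beta> "X - Z" "X - Z'", unfolded d]
    unfolding aug_lagrangian_def lagrangian_def i n R_def[symmetric] inner_minus_right mult_minus_right norm_minus_cancel
      add_divide_distrib distrib_right
    by linarith
qed

text \<open>As for X: the linear part vanishes at \<open>W'\<close>, the square of
  \<open>D ** X\<close> is dropped, and the penalty on \<open>Z ** N - W\<close> supplies the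
  decrease.\<close>

lemma aug_lagrangian_descent_W:
  fixes A N K :: "real^'n^'n"
  assumes st: "W' ** (X ** transpose X + \<gamma> *\<^sub>R mat 1) =
      (Y + Z ** A + K) ** transpose X - Gam + \<gamma> *\<^sub>R (Z ** N)"
  shows "aug_lagrangian A N K \<alpha> \<beta> \<gamma> X Y Z W' Lam Pim Gam + \<gamma>/2 * (norm (W' - W))\<^sup>2
    \<le> aug_lagrangian A N K \<alpha> \<beta> \<gamma> X Y Z W Lam Pim Gam"
proof -
  define D where "D = W - W'"
  define R where "R = Y + Z ** A - W' ** X + K"
  have W: "W = W' + D" by (simp add: D_def)
  have "Gam - R ** transpose X - \<gamma> *\<^sub>R (Z ** N - W') = 0"
    using st unfolding R_def
    by (simp add: matrix_ring_simps matrix_scaleR_simps matrix_mul_assoc algebra_simps)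
  then have "(Gam - R ** transpose X - \<gamma> *\<^sub>R (Z ** N - W')) \<bullet> D = 0" by simp
  then have g: "R \<bullet> (- (D ** X)) + Gam \<bullet> D + \<gamma> * ((Z ** N - W') \<bullet> (- D)) = 0"
    by (simp add: inner_diff_left inner_add_left inner_matrix_mult_right[of _ _ X] algebra_simps)
  have d: "Y + Z ** A - W ** X + K - R = - (D ** X)"
    "Z ** N - W - (Z ** N - W') = - D"
    by (simp_all add: W R_def matrix_ring_simps)
  have i: "Gam \<bullet> (Z ** N - W) = Gam \<bullet> (Z ** N - W') - Gam \<bullet> D"
    by (simp add: W inner_simps)
  have n: "norm (W' - W) = norm D" by (simp add: D_def norm_minus_commute)
  show ?thesis
    using g zero_le_power2[of "norm (- (D ** X))"]
      half_norm_square_expand[of 1 "Y + Z ** A - W ** X + K" R, unfolded d]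
      half_norm_square_expand[of \<gamma> "Z ** N - W" "Z ** N - W'", unfolded d]
    unfolding aug_lagrangian_def lagrangian_def i n R_def[symmetric] inner_minus_right mult_minus_right norm_minus_cancel
      add_divide_distrib distrib_right
    by linarith
qed

text \<open>Only the multiplier terms change. Each change of multiplier is minus the penalty
  parameter times a constraint residual, so its pairing with that residual is a squared norm divided
  by the parameter.\<close>

lemma aug_lagrangian_multiplier_step:
  assumes "0 < \<alpha>" "0 < \<beta>" "0 < \<gamma>"
    and "Lam' = Lam - \<alpha> *\<^sub>R (transpose A ** X - Y)"
    and "Pim' = Pim - \<beta> *\<^sub>R (X - Z)"
    and "Gam' = Gam - \<gamma> *\<^sub>R (Z ** N - W)"
  shows "aug_lagrangian A N K \<alpha> \<beta> \<gamma> X Y Z W Lam' Pim' Gam' =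
    aug_lagrangian A N K \<alpha> \<beta> \<gamma> X Y Z W Lam Pim Gam
    + ((norm (Lam' - Lam))\<^sup>2 / \<alpha> + (norm (Pim' - Pim))\<^sup>2 / \<beta> + (norm (Gam' - Gam))\<^sup>2 / \<gamma>)"
  using assms(1-3) unfolding aug_lagrangian_def lagrangian_def assms(4-6)
  by (simp add: power_mult_distrib inner_diff_left power2_norm_eq_inner)
    (simp add: power2_eq_square inner_diff_left)

section \<open>Summability of the steps and limits along subsequences\<close>

text \<open>Telescoping bounds the partial sums of \<open>e\<close> by
  \<open>F 0 + suminf s - b\<close>.\<close>

lemma summable_of_perturbed_descent:
  fixes F e s :: "nat \<Rightarrow> real"
  assumes le: "\<And>k. F (Suc k) + e k \<le> F k + s k"
    and lb: "\<And>k. b \<le> F k" and e: "\<And>k. 0 \<le> e k" and s: "\<And>k. 0 \<le> s k" "summable s"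
  shows "summable e"
proof (rule bounded_imp_summable[OF e])
  fix n
  have *: "F n + (\<Sum>k<n. e k) \<le> F 0 + (\<Sum>k<n. s k)" for n
  proof (induction n)
    case (Suc n)
    then show ?case using le[of n] by simp
  qed simp
  \<comment> \<open>The summability criterion wants sums over \<open>k \<le> n\<close>, so the
    telescoped bound is used at \<open>Suc n\<close>.\<close>
  have "(\<Sum>k<Suc n. s k) \<le> suminf s" by (rule sum_le_suminf) (use s in auto)
  then show "(\<Sum>k\<le>n. e k) \<le> F 0 + suminf s - b"
    using *[of "Suc n"] lb[of "Suc n"] unfolding lessThan_Suc_atMost by linarith
qed

lemma tendsto_zero_of_scaled_power2:
  fixes d :: "nat \<Rightarrow> 'a::real_normed_vector"
  assumes "summable (\<lambda>k. c * (norm (d k))\<^sup>2)" "c \<noteq> 0"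
  shows "d \<longlonglongrightarrow> 0"
proof -
  have "(\<lambda>k. (norm (d k))\<^sup>2) \<longlonglongrightarrow> 0"
    using summable_LIMSEQ_zero assms summable_cmult_iff by blast
  then have "(\<lambda>k. sqrt ((norm (d k))\<^sup>2)) \<longlonglongrightarrow> 0"
    using tendsto_real_sqrt by fastforce
  then show ?thesis by (simp add: tendsto_norm_zero_iff)
qed

text \<open>The vanishing step is added to \<open>u (r j)\<close>. The shift is applied after
  \<open>r\<close>: the index is \<open>Suc (r j)\<close>, not \<open>r (Suc j)\<close>, and the
  shifted terms need not belong to the subsequence.\<close>

lemma tendsto_Suc_subseq:
  fixes u :: "nat \<Rightarrow> 'a::real_normed_vector"
  assumes "(\<lambda>k. u (Suc k) - u k) \<longlonglongrightarrow> 0" "strict_mono r" "(\<lambda>j. u (r j)) \<longlonglongrightarrow> l"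
  shows "(\<lambda>j. u (Suc (r j))) \<longlonglongrightarrow> l"
proof -
  have "(\<lambda>j. u (Suc (r j)) - u (r j)) \<longlonglongrightarrow> 0"
    using LIMSEQ_subseq_LIMSEQ[OF assms(1,2)] by (simp add: comp_def)
  from tendsto_add[OF this assms(3)] show ?thesis by simp
qed

lemma tendsto_transpose [tendsto_intros]:
  fixes f :: "'b \<Rightarrow> real^'n^'m"
  assumes "(f \<longlongrightarrow> l) F"
  shows "((\<lambda>x. transpose (f x)) \<longlongrightarrow> transpose l) F"
  unfolding transpose_def by (intro tendsto_intros assms)

section \<open>Descent and vanishing steps along the ADMM iteration\<close>

text \<open>The inverse-free updates serve twice: as stationarity conditions for the descent lemmas,
  and as polynomial equations whose limits need no continuity of the inverse.\<close>

lemma admm_iteration_normal_equations: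
  assumes "admm_iteration A N K \<alpha> \<beta> \<gamma> X Y Z W Lam Pim Gam"
    and "0 < \<alpha>" "0 < \<beta>" "0 < \<gamma>"
  shows "(transpose (W k) ** W k + \<alpha> *\<^sub>R (A ** transpose A) + \<beta> *\<^sub>R mat 1) ** X (Suc k) =
      transpose (W k) ** (Y k + Z k ** A + K) + A ** Lam k + Pim k + \<alpha> *\<^sub>R (A ** Y k) + \<beta> *\<^sub>R Z k"
    and "(1 + \<alpha>) *\<^sub>R Y (Suc k) =
      W k ** X (Suc k) + \<alpha> *\<^sub>R (transpose A ** X (Suc k)) - Z k ** A - K - Lam k"
    and "Z (Suc k) ** (A ** transpose A + \<beta> *\<^sub>R mat 1 + \<gamma> *\<^sub>R (N ** transpose N)) =
      (W k ** X (Suc k) - Y (Suc k) - K) ** transpose A - Pim k + Gam k ** transpose N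
        + \<beta> *\<^sub>R X (Suc k) + \<gamma> *\<^sub>R (W k ** transpose N)"
    and "W (Suc k) ** (X (Suc k) ** transpose (X (Suc k)) + \<gamma> *\<^sub>R mat 1) =
      (Y (Suc k) + Z (Suc k) ** A + K) ** transpose (X (Suc k)) - Gam k + \<gamma> *\<^sub>R (Z (Suc k) ** N)"
proof -
  note it = assms(1)[unfolded admm_iteration_def, rule_format, of k]
  show "(transpose (W k) ** W k + \<alpha> *\<^sub>R (A ** transpose A) + \<beta> *\<^sub>R mat 1) ** X (Suc k) =
      transpose (W k) ** (Y k + Z k ** A + K) + A ** Lam k + Pim k + \<alpha> *\<^sub>R (A ** Y k) + \<beta> *\<^sub>R Z k"
    using invertible_normal_matrix[of \<beta> \<alpha> 1 "transpose (W k)" A] assms(2-4) it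
    by (intro matrix_inv_mult_eq(1)) auto
  have "1 + \<alpha> \<noteq> 0" using assms(2) by simp
  then show "(1 + \<alpha>) *\<^sub>R Y (Suc k) =
      W k ** X (Suc k) + \<alpha> *\<^sub>R (transpose A ** X (Suc k)) - Z k ** A - K - Lam k"
    using it by simp
  show "Z (Suc k) ** (A ** transpose A + \<beta> *\<^sub>R mat 1 + \<gamma> *\<^sub>R (N ** transpose N)) =
      (W k ** X (Suc k) - Y (Suc k) - K) ** transpose A - Pim k + Gam k ** transpose N
        + \<beta> *\<^sub>R X (Suc k) + \<gamma> *\<^sub>R (W k ** transpose N)"
    using invertible_normal_matrix[of \<beta> \<gamma> 1 A N] assms(2-4) it
    by (intro matrix_inv_mult_eq(2)) (auto simp: ac_simps)
  show "W (Suc k) ** (X (Suc k) ** transpose (X (Suc k)) + \<gamma> *\<^sub>R mat 1) =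
      (Y (Suc k) + Z (Suc k) ** A + K) ** transpose (X (Suc k)) - Gam k + \<gamma> *\<^sub>R (Z (Suc k) ** N)"
    \<comment> \<open>The coefficient 0 removes the second Gram term.\<close>
    using invertible_normal_matrix[of \<gamma> 0 1 "X (Suc k)"] assms(2-4) it
    by (intro matrix_inv_mult_eq(2)) auto
qed

text \<open>The four block decreases and the multiplier increase are chained in the order of the
  updates, so that the intermediate values cancel.\<close>

lemma admm_aug_lagrangian_descent:
  assumes "admm_iteration A N K \<alpha> \<beta> \<gamma> X Y Z W Lam Pim Gam"
    and "0 < \<alpha>" "0 < \<beta>" "0 < \<gamma>"
  shows "aug_lagrangian A N K \<alpha> \<beta> \<gamma> (X (Suc k)) (Y (Suc k)) (Z (Suc k)) (W (Suc k))
        (Lam (Suc k)) (Pim (Suc k)) (Gam (Suc k))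
      + (\<beta>/2 * (norm (X (Suc k) - X k))\<^sup>2 + (1 + \<alpha>)/2 * (norm (Y (Suc k) - Y k))\<^sup>2
         + \<beta>/2 * (norm (Z (Suc k) - Z k))\<^sup>2 + \<gamma>/2 * (norm (W (Suc k) - W k))\<^sup>2)
    \<le> aug_lagrangian A N K \<alpha> \<beta> \<gamma> (X k) (Y k) (Z k) (W k) (Lam k) (Pim k) (Gam k)
      + ((norm (Lam (Suc k) - Lam k))\<^sup>2 / \<alpha> + (norm (Pim (Suc k) - Pim k))\<^sup>2 / \<beta>
         + (norm (Gam (Suc k) - Gam k))\<^sup>2 / \<gamma>)"
proof -
  note eqs = admm_iteration_normal_equations[OF assms, of k]
  note it = assms(1)[unfolded admm_iteration_def, rule_format, of k]
  show ?thesis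
    using aug_lagrangian_descent_X[OF assms(2) eqs(1), where \<gamma> = \<gamma> and N = N and X = "X k" and Gam = "Gam k"]
      aug_lagrangian_descent_Y[OF eqs(2), where \<beta> = \<beta> and \<gamma> = \<gamma> and N = N and Y = "Y k" and Pim = "Pim k" and Gam = "Gam k"]
      aug_lagrangian_descent_Z[OF assms(4) eqs(3), where \<alpha> = \<alpha> and Z = "Z k" and Lam = "Lam k"]
      aug_lagrangian_descent_W[OF eqs(4), where \<alpha> = \<alpha> and \<beta> = \<beta> and W = "W k" and Lam = "Lam k" and Pim = "Pim k"]
      aug_lagrangian_multiplier_step[OF assms(2-4), of "Lam (Suc k)" "Lam k" A "X (Suc k)" "Y (Suc k)"
        "Pim (Suc k)" "Pim k" "Z (Suc k)" "Gam (Suc k)" "Gam k" N "W (Suc k)" K] it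
    by linarith
qed

lemma admm_primal_steps_tendsto_zero:
  assumes it: "admm_iteration A N K \<alpha> \<beta> \<gamma> X Y Z W Lam Pim Gam"
    and pos: "0 < \<alpha>" "0 < \<beta>" "0 < \<gamma>"
    and bd: "bounded (range (\<lambda>k. (Lam k, Pim k, Gam k)))"
    and sum: "summable (\<lambda>k. (norm (Lam (Suc k) - Lam k))\<^sup>2)"
      "summable (\<lambda>k. (norm (Pim (Suc k) - Pim k))\<^sup>2)"
      "summable (\<lambda>k. (norm (Gam (Suc k) - Gam k))\<^sup>2)"
  shows "(\<lambda>k. X (Suc k) - X k) \<longlonglongrightarrow> 0" "(\<lambda>k. Y (Suc k) - Y k) \<longlonglongrightarrow> 0"
    "(\<lambda>k. Z (Suc k) - Z k) \<longlonglongrightarrow> 0" "(\<lambda>k. W (Suc k) - W k) \<longlonglongrightarrow> 0"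
proof -
  obtain B where B: "\<And>k. norm (Lam k, Pim k, Gam k) \<le> B"
    using bd unfolding bounded_iff by auto
  have B': "norm (Lam k) \<le> B \<and> norm (Pim k) \<le> B \<and> norm (Gam k) \<le> B" for k
    using B[of k] norm_fst_le[of "Lam k" "(Pim k, Gam k)"] norm_snd_le[of "(Pim k, Gam k)" "Lam k"]
      norm_fst_le[of "Pim k" "Gam k"] norm_snd_le[of "Gam k" "Pim k"] by linarith
  \<comment> \<open>This is the bound of \<open>aug_lagrangian_ge\<close> with each multiplier norm
    replaced by the common bound \<open>B\<close>.\<close>
  define b where "b = - (B\<^sup>2 / (2 * \<alpha>) + B\<^sup>2 / (2 * \<beta>) + B\<^sup>2 / (2 * \<gamma>))"
  define e where "e k = \<beta>/2 * (norm (X (Suc k) - X k))\<^sup>2 + (1 + \<alpha>)/2 * (norm (Y (Suc k) - Y k))\<^sup>2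
      + \<beta>/2 * (norm (Z (Suc k) - Z k))\<^sup>2 + \<gamma>/2 * (norm (W (Suc k) - W k))\<^sup>2" for k
  have "summable e"
  proof (rule summable_of_perturbed_descent[where
        F = "\<lambda>k. aug_lagrangian A N K \<alpha> \<beta> \<gamma> (X k) (Y k) (Z k) (W k) (Lam k) (Pim k) (Gam k)"])
    show "aug_lagrangian A N K \<alpha> \<beta> \<gamma> (X (Suc k)) (Y (Suc k)) (Z (Suc k)) (W (Suc k))
        (Lam (Suc k)) (Pim (Suc k)) (Gam (Suc k)) + e k
      \<le> aug_lagrangian A N K \<alpha> \<beta> \<gamma> (X k) (Y k) (Z k) (W k) (Lam k) (Pim k) (Gam k)
        + ((norm (Lam (Suc k) - Lam k))\<^sup>2 / \<alpha> + (norm (Pim (Suc k) - Pim k))\<^sup>2 / \<beta>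
           + (norm (Gam (Suc k) - Gam k))\<^sup>2 / \<gamma>)" for k
      unfolding e_def by (rule admm_aug_lagrangian_descent[OF it pos])
    fix k
    have "b \<le> - ((norm (Lam k))\<^sup>2 / (2 * \<alpha>) + (norm (Pim k))\<^sup>2 / (2 * \<beta>) + (norm (Gam k))\<^sup>2 / (2 * \<gamma>))"
      unfolding b_def using B'[of k] pos
      by (intro le_imp_neg_le add_mono divide_right_mono power_mono) auto
    then show "b \<le> aug_lagrangian A N K \<alpha> \<beta> \<gamma> (X k) (Y k) (Z k) (W k) (Lam k) (Pim k) (Gam k)"
      using aug_lagrangian_ge[OF pos] by (rule order_trans)
    show "0 \<le> e k" using pos by (simp add: e_def)
  qed (use pos in \<open>auto intro!: summable_add summable_divide sum\<close>)
  \<comment> \<open>Every summand of \<open>e\<close> is nonnegative, so each weighted squared step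
    is dominated by \<open>e\<close> from index 0 on.\<close>
  note comp = tendsto_zero_of_scaled_power2[OF summable_comparison_test'[OF this, of 0]]
  show "(\<lambda>k. X (Suc k) - X k) \<longlonglongrightarrow> 0"
    by (rule comp[where c = "\<beta>/2"]) (use pos in \<open>auto simp: e_def\<close>)
  show "(\<lambda>k. Y (Suc k) - Y k) \<longlonglongrightarrow> 0"
    by (rule comp[where c = "(1 + \<alpha>)/2"]) (use pos in \<open>auto simp: e_def\<close>)
  show "(\<lambda>k. Z (Suc k) - Z k) \<longlonglongrightarrow> 0"
    by (rule comp[where c = "\<beta>/2"]) (use pos in \<open>auto simp: e_def\<close>)
  show "(\<lambda>k. W (Suc k) - W k) \<longlonglongrightarrow> 0"
    by (rule comp[where c = "\<gamma>/2"]) (use pos in \<open>auto simp: e_def\<close>)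
qed

section \<open>Passage to the limit in the update equations\<close>

theorem theorem4:
  fixes A N K :: "real^'n^'n"
    and \<alpha> \<beta> \<gamma> :: real
    and X Y Z W Lam Pim Gam :: "nat \<Rightarrow> real^'n^'n"
    and Xs Ys Zs Ws Lams Pims Gams :: "real^'n^'n"
  assumes "sym_psd N" and "sym_psd K"
    and "\<alpha> > 0" and "\<beta> > 0" and "\<gamma> > 0"
    and "admm_iteration A N K \<alpha> \<beta> \<gamma> X Y Z W Lam Pim Gam"
    and "bounded (range (\<lambda>k. (Lam k, Pim k, Gam k)))"
    and "summable (\<lambda>k. (norm (Lam (Suc k) - Lam k))\<^sup>2 + (norm (Pim (Suc k) - Pim k))\<^sup>2
                       + (norm (Gam (Suc k) - Gam k))\<^sup>2)"
    and "\<exists>r. strict_mono (r :: nat \<Rightarrow> nat) \<and>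
           (\<lambda>j. (X (r j), Y (r j), Z (r j), W (r j), Lam (r j), Pim (r j), Gam (r j)))
             \<longlonglongrightarrow> (Xs, Ys, Zs, Ws, Lams, Pims, Gams)"
  shows "kkt_point A N K Xs Ys Zs Ws Lams Pims Gams"
proof -
  note pos = assms(3-5) and it = assms(6)
  obtain r :: "nat \<Rightarrow> nat" where r: "strict_mono r"
    and lim: "(\<lambda>j. (X (r j), Y (r j), Z (r j), W (r j), Lam (r j), Pim (r j), Gam (r j)))
             \<longlonglongrightarrow> (Xs, Ys, Zs, Ws, Lams, Pims, Gams)"
    using assms(9) by blast
  have L: "(\<lambda>j. X (r j)) \<longlonglongrightarrow> Xs" "(\<lambda>j. Y (r j)) \<longlonglongrightarrow> Ys" "(\<lambda>j. Z (r j)) \<longlonglongrightarrow> Zs"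
    "(\<lambda>j. W (r j)) \<longlonglongrightarrow> Ws" "(\<lambda>j. Lam (r j)) \<longlonglongrightarrow> Lams" "(\<lambda>j. Pim (r j)) \<longlonglongrightarrow> Pims"
    "(\<lambda>j. Gam (r j)) \<longlonglongrightarrow> Gams"
    using tendsto_fst[OF lim] tendsto_fst[OF tendsto_snd[OF lim]]
      tendsto_fst[OF tendsto_snd[OF tendsto_snd[OF lim]]]
      tendsto_fst[OF tendsto_snd[OF tendsto_snd[OF tendsto_snd[OF lim]]]]
      tendsto_fst[OF tendsto_snd[OF tendsto_snd[OF tendsto_snd[OF tendsto_snd[OF lim]]]]]
      tendsto_fst[OF tendsto_snd[OF tendsto_snd[OF tendsto_snd[OF tendsto_snd[OF tendsto_snd[OF lim]]]]]]
      tendsto_snd[OF tendsto_snd[OF tendsto_snd[OF tendsto_snd[OF tendsto_snd[OF tendsto_snd[OF lim]]]]]]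
    by simp_all
  have sum: "summable (\<lambda>k. (norm (Lam (Suc k) - Lam k))\<^sup>2)"
    "summable (\<lambda>k. (norm (Pim (Suc k) - Pim k))\<^sup>2)"
    "summable (\<lambda>k. (norm (Gam (Suc k) - Gam k))\<^sup>2)"
    by (rule summable_comparison_test'[OF assms(8), of 0]; simp)+
  note step = tendsto_Suc_subseq[OF _ r]
  note P = admm_primal_steps_tendsto_zero[OF it pos assms(7) sum]
  note L' = step[OF P(1) L(1)] step[OF P(2) L(2)] step[OF P(3) L(3)] step[OF P(4) L(4)]
  have M: "(\<lambda>j. Lam (Suc (r j))) \<longlonglongrightarrow> Lams" "(\<lambda>j. Pim (Suc (r j))) \<longlonglongrightarrow> Pims"
    "(\<lambda>j. Gam (Suc (r j))) \<longlonglongrightarrow> Gams"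
    by (auto intro!: step L tendsto_zero_of_scaled_power2[where c = 1] simp: sum)
  note [tendsto_intros] = bounded_bilinear.tendsto[OF bounded_bilinear_matrix_mult]
  have mult: "Lam (Suc k) = Lam k - \<alpha> *\<^sub>R (transpose A ** X (Suc k) - Y (Suc k))"
    "Pim (Suc k) = Pim k - \<beta> *\<^sub>R (X (Suc k) - Z (Suc k))"
    "Gam (Suc k) = Gam k - \<gamma> *\<^sub>R (Z (Suc k) ** N - W (Suc k))" for k
    using it unfolding admm_iteration_def by blast+
  \<comment> \<open>Both sides of the multiplier update converge along the subsequence, the old and
    new multipliers to the same limit; since \<alpha> > 0, the constraint holds in the limit. The
    other two constraints follow likewise.\<close>
  have "Lams = Lams - \<alpha> *\<^sub>R (transpose A ** Xs - Ys)"
    by (rule LIMSEQ_unique[OF M(1)]) (unfold mult, intro tendsto_intros L L')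
  then have f1: "transpose A ** Xs = Ys" using pos by simp
  have "Pims = Pims - \<beta> *\<^sub>R (Xs - Zs)"
    by (rule LIMSEQ_unique[OF M(2)]) (unfold mult, intro tendsto_intros L L')
  then have f2: "Xs = Zs" using pos by simp
  have "Gams = Gams - \<gamma> *\<^sub>R (Zs ** N - Ws)"
    by (rule LIMSEQ_unique[OF M(3)]) (unfold mult, intro tendsto_intros L L')
  then have f3: "Zs ** N = Ws" using pos by simp
  note eqs = admm_iteration_normal_equations[OF it pos]
  \<comment> \<open>The left side of the normal equation, taken along \<open>r\<close>, has two
    limits: one computed directly, the other after rewriting it by \<open>eqs(1)\<close> into the
    right side.\<close>
  have "(transpose Ws ** Ws + \<alpha> *\<^sub>R (A ** transpose A) + \<beta> *\<^sub>R mat 1) ** Xs =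
      transpose Ws ** (Ys + Zs ** A + K) + A ** Lams + Pims + \<alpha> *\<^sub>R (A ** Ys) + \<beta> *\<^sub>R Zs"
    by (rule LIMSEQ_unique[where X = "\<lambda>j. (transpose (W (r j)) ** W (r j)
          + \<alpha> *\<^sub>R (A ** transpose A) + \<beta> *\<^sub>R mat 1) ** X (Suc (r j))"],
        (intro tendsto_intros L L')[1], unfold eqs(1), intro tendsto_intros L L')
  \<comment> \<open>Feasibility cancels the \<alpha> and \<beta> terms, leaving stationarity of the
    ordinary Lagrangian. The penalty terms in \<open>k2\<close>, \<open>k3\<close> and
    \<open>k4\<close> cancel in the same way.\<close>
  then have k1: "transpose Ws ** Ws ** Xs - transpose Ws ** (Ys + Zs ** A + K) - A ** Lams - Pims = 0"
    by (simp add: f1 f2[symmetric] matrix_ring_simps matrix_scaleR_simps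
        matrix_mul_assoc[symmetric] algebra_simps)
  have "(1 + \<alpha>) *\<^sub>R Ys = Ws ** Xs + \<alpha> *\<^sub>R (transpose A ** Xs) - Zs ** A - K - Lams"
    by (rule LIMSEQ_unique[where X = "\<lambda>j. (1 + \<alpha>) *\<^sub>R Y (Suc (r j))"],
        (intro tendsto_intros L L')[1], unfold eqs(2), intro tendsto_intros L L')
  then have k2: "Ys + Zs ** A - Ws ** Xs + K + Lams = 0"
    by (simp add: f1 algebra_simps)
  have "Zs ** (A ** transpose A + \<beta> *\<^sub>R mat 1 + \<gamma> *\<^sub>R (N ** transpose N)) =
      (Ws ** Xs - Ys - K) ** transpose A - Pims + Gams ** transpose N
        + \<beta> *\<^sub>R Xs + \<gamma> *\<^sub>R (Ws ** transpose N)"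
    by (rule LIMSEQ_unique[where X = "\<lambda>j. Z (Suc (r j)) **
          (A ** transpose A + \<beta> *\<^sub>R mat 1 + \<gamma> *\<^sub>R (N ** transpose N))"],
        (intro tendsto_intros L L')[1], unfold eqs(3), intro tendsto_intros L L')
  then have k3: "Zs ** A ** transpose A + (Ys - Ws ** Xs + K) ** transpose A + Pims
      - Gams ** transpose N = 0"
    by (simp add: f2 f3[symmetric] matrix_ring_simps matrix_scaleR_simps
        matrix_mul_assoc algebra_simps)
  have "Ws ** (Xs ** transpose Xs + \<gamma> *\<^sub>R mat 1) =
      (Ys + Zs ** A + K) ** transpose Xs - Gams + \<gamma> *\<^sub>R (Zs ** N)"
    by (rule LIMSEQ_unique[where X = "\<lambda>j. W (Suc (r j)) **
          (X (Suc (r j)) ** transpose (X (Suc (r j))) + \<gamma> *\<^sub>R mat 1)"],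
        (intro tendsto_intros L L')[1], unfold eqs(4), intro tendsto_intros L L')
  then have k4: "Ws ** Xs ** transpose Xs - (Ys + Zs ** A + K) ** transpose Xs + Gams = 0"
    by (simp add: f3 matrix_ring_simps matrix_scaleR_simps matrix_mul_assoc algebra_simps)
  show ?thesis
    unfolding kkt_point_def using k1 k2 k3 k4 f1 f2 f3 by simp
qed

end
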